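(* If $K$ is a $P$-complex of rank $n$ and $\sigma$ is a face simplex of $K$ of rank $k$, then $\mathrm{link}_K\,\sigma$ is a $P$-complex of rank $n-k$.
   Context: For a finite simplicial complex $K$, let $M(K)$ be the set of its inclusion-maximal simplices. A simplex $\tau\in K$ is a face simplex if $\tau=\sigma_1\cap\dots\cap\sigma_s$ for some $\sigma_1,\dots,\sigma_s\in M(K)$ ($s\ge1$). $F(K)$ denotes the set of all face simplices, ordered by inclusion. $K$ is called a polytopic complex ($P$-complex) of rank $n$ if: (1) $\varnothing\in F(K)$, i.e. the intersection of all maximal simplices is empty; (2) $F(K)$ is a graded poset of rank $n$, i.e. all its inclusion-maximal chains have the same number $n+1$ of elements, so that a rank function $\mathrm{rk}$ is defined with $\mathrm{rk}(\varnothing)=0$, with $\mathrm{rk}$ increasing by $1$ along covering relations, and with $\mathrm{rk}(\sigma)=n$ for maximal simplices $\sigma$; (3) for every $\sigma\in F(K)$ there is a simplicial subcomplex $Z_\sigma$ of $\mathrm{link}_K\sigma$ such that (the geometric realization of) $Z_\sigma$ is homeomorphic to the sphere $S^{n-\mathrm{rk}(\sigma)-1}$ and $Z_\sigma$ is a strong deformation retract of $\mathrm{link}_K\sigma$; here $\mathrm{link}_K\varnothing=K$ and $S^{-1}=\varnothing$. The rank of a face simplex is its value under $\mathrm{rk}$. As usual $\mathrm{link}_K\sigma=\{\tau\in K\mid\tau\cap\sigma=\varnothing,\ \tau\cup\sigma\in K\}$. *)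

theory Defs
  imports "HOL-Analysis.Analysis"
begin

section \<open>Abstract simplicial complexes and links\<close>

text \<open>The empty set counts as a simplex, so the smallest complex is \<open>{{}}\<close>.\<close>

definition finite_simplicial_complex :: "'a set set \<Rightarrow> bool" where
  "finite_simplicial_complex K \<longleftrightarrow>
     finite K \<and> {} \<in> K \<and> (\<forall>\<sigma>\<in>K. finite \<sigma> \<and> (\<forall>\<tau>. \<tau> \<subseteq> \<sigma> \<longrightarrow> \<tau> \<in> K))"

definition link :: "'a set set \<Rightarrow> 'a set \<Rightarrow> 'a set set" where
  "link K \<sigma> = {\<tau> \<in> K. \<tau> \<inter> \<sigma> = {} \<and> \<tau> \<union> \<sigma> \<in> K}"

text \<open>
  Geometric realization in barycentric coordinates: a point is a function on the vertices.
  The empty simplex contributes no point, since an empty sum is not 1.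
\<close>

definition realization :: "'a set set \<Rightarrow> ('a \<Rightarrow> real) topology" where
  "realization K = subtopology (powertop_real UNIV)
     {x. {v. x v \<noteq> 0} \<in> K \<and> (\<forall>v. 0 \<le> x v) \<and> (\<Sum>v | x v \<noteq> 0. x v) = 1}"

section \<open>Face simplices and their rank\<close>

definition maximal_simplices :: "'a set set \<Rightarrow> 'a set set" where
  "maximal_simplices K = {\<sigma> \<in> K. \<forall>\<tau>\<in>K. \<sigma> \<subseteq> \<tau> \<longrightarrow> \<tau> = \<sigma>}"

definition face_simplices :: "'a set set \<Rightarrow> 'a set set" where
  "face_simplices K =
     {\<tau> \<in> K. \<exists>S. finite S \<and> S \<noteq> {} \<and> S \<subseteq> maximal_simplices K \<and> \<tau> = \<Inter>S}"

definition graded_of_rank :: "'a set set \<Rightarrow> nat \<Rightarrow> bool" where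
  "graded_of_rank F n \<longleftrightarrow> (\<forall>C. subset.maxchain F C \<longrightarrow> card C = n + 1)"

definition covers :: "'a set set \<Rightarrow> 'a set \<Rightarrow> 'a set \<Rightarrow> bool" where
  "covers F \<tau> \<sigma> \<longleftrightarrow> \<sigma> \<in> F \<and> \<tau> \<in> F \<and> \<sigma> \<subset> \<tau> \<and> \<not> (\<exists>\<rho>\<in>F. \<sigma> \<subset> \<rho> \<and> \<rho> \<subset> \<tau>)"

definition rank_function :: "'a set set \<Rightarrow> ('a set \<Rightarrow> nat) \<Rightarrow> bool" where
  "rank_function K rk \<longleftrightarrow> rk {} = 0 \<and>
     (\<forall>\<sigma> \<tau>. covers (face_simplices K) \<tau> \<sigma> \<longrightarrow> rk \<tau> = rk \<sigma> + 1)"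

text \<open>
  The common value at \<open>\<sigma>\<close> of all rank functions; see \<open>face_rank_eqI\<close>,
  \<open>rank_function_face_rank\<close>, \<open>face_rank_maximal\<close> and \<open>face_rank_le\<close> below.
\<close>

definition face_rank :: "'a set set \<Rightarrow> 'a set \<Rightarrow> nat" where
  "face_rank K \<sigma> = (THE r. \<exists>rk. rank_function K rk \<and> rk \<sigma> = r)"

section \<open>Polytopic complexes\<close>

text \<open>The sphere of dimension \<open>m - 1\<close>, which is empty for \<open>m = 0\<close>.\<close>

definition sphere_pred :: "nat \<Rightarrow> (nat \<Rightarrow> real) topology" where
  "sphere_pred m = (case m of 0 \<Rightarrow> trivial_topology | Suc d \<Rightarrow> nsphere d)"

text \<open>The homotopy from the identity to the retraction fixes \<open>A\<close> pointwise at all times.\<close>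

definition strong_deformation_retract_of :: "'a set \<Rightarrow> 'a topology \<Rightarrow> bool" where
  "strong_deformation_retract_of A X \<longleftrightarrow> A \<subseteq> topspace X \<and>
     (\<exists>r. retraction_maps X (subtopology X A) r id \<and>
          homotopic_with (\<lambda>h. \<forall>a\<in>A. h a = a) X X id r)"

definition P_complex :: "'a set set \<Rightarrow> nat \<Rightarrow> bool" where
  "P_complex K n \<longleftrightarrow>
     finite_simplicial_complex K \<and>
     {} \<in> face_simplices K \<and>
     graded_of_rank (face_simplices K) n \<and>
     (\<forall>\<sigma>\<in>face_simplices K. \<exists>Z. finite_simplicial_complex Z \<and> Z \<subseteq> link K \<sigma> \<and>
        realization Z homeomorphic_space sphere_pred (n - face_rank K \<sigma>) \<and>
        strong_deformation_retract_of (topspace (realization Z)) (realization (link K \<sigma>)))"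

section \<open>The rank is well defined\<close>

lemma maxchain_memI:
  assumes "subset.maxchain A C" "x \<in> A" "\<And>y. y \<in> C \<Longrightarrow> x \<subseteq> y \<or> y \<subseteq> x"
  shows "x \<in> C"
proof (rule ccontr)
  assume x: "x \<notin> C"
  have "subset.chain A (insert x C)"
    using assms by (auto simp: subset.maxchain_def subset_chain_insert)
  moreover have "C \<subset> insert x C" using x by auto
  ultimately show False using assms(1) by (auto simp: subset.maxchain_def)
qed

lemma maxchain_memD:
  assumes "subset.maxchain A C" "x \<in> C"
  shows "x \<in> A" "\<And>y. y \<in> C \<Longrightarrow> x \<subseteq> y \<or> y \<subseteq> x"
  using assms by (auto simp: subset.maxchain_def subset_chain_def)

lemma maxchainI:
  assumes "C \<subseteq> A" "\<And>x y. x \<in> C \<Longrightarrow> y \<in> C \<Longrightarrow> x \<subseteq> y \<or> y \<subseteq> x"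
    and "\<And>x. x \<in> A \<Longrightarrow> (\<And>y. y \<in> C \<Longrightarrow> x \<subseteq> y \<or> y \<subseteq> x) \<Longrightarrow> x \<in> C"
  shows "subset.maxchain A C"
  unfolding subset.maxchain_def
proof (intro conjI notI)
  show "subset.chain A C" using assms(1,2) by (auto simp: subset_chain_def)
next
  assume "\<exists>S. subset.chain A S \<and> C \<subset> S"
  then obtain S x where "subset.chain A S" "C \<subseteq> S" "x \<in> S" "x \<notin> C" by blast
  then show False using assms(3)[of x] by (auto simp: subset_chain_def subset_iff)
qed

abbreviation (input) below :: "'a set set \<Rightarrow> 'a set \<Rightarrow> 'a set set" where
  "below F \<sigma> \<equiv> {\<tau> \<in> F. \<tau> \<subseteq> \<sigma>}"

abbreviation (input) above :: "'a set set \<Rightarrow> 'a set \<Rightarrow> 'a set set" where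
  "above F \<sigma> \<equiv> {\<tau> \<in> F. \<sigma> \<subseteq> \<tau>}"

lemma maxchain_glue:
  assumes D: "subset.maxchain (below F \<sigma>) D" and E: "subset.maxchain (above F \<sigma>) E"
    and "\<sigma> \<in> F"
  shows "D \<inter> E = {\<sigma>}" "subset.maxchain F (D \<union> E)"
proof -
  have sD: "\<sigma> \<in> D" 
    by (rule maxchain_memI[OF D]) (use \<open>\<sigma> \<in> F\<close> maxchain_memD(1)[OF D] in auto)
  have sE: "\<sigma> \<in> E" 
    by (rule maxchain_memI[OF E]) (use \<open>\<sigma> \<in> F\<close> maxchain_memD(1)[OF E] in auto)
  have subD: "x \<in> F \<and> x \<subseteq> \<sigma>" if "x \<in> D" for x using maxchain_memD(1)[OF D that] by auto
  have subE: "x \<in> F \<and> \<sigma> \<subseteq> x" if "x \<in> E" for x using maxchain_memD(1)[OF E that] by auto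
  show "D \<inter> E = {\<sigma>}" using sD sE subD subE by blast
  show "subset.maxchain F (D \<union> E)"
  proof (rule maxchainI)
    show "D \<union> E \<subseteq> F" using subD subE by blast
  next
    fix x y assume "x \<in> D \<union> E" "y \<in> D \<union> E"
    then show "x \<subseteq> y \<or> y \<subseteq> x"
      using maxchain_memD(2)[OF D] maxchain_memD(2)[OF E] subD subE
      by (meson UnE subset_trans)
  next
    fix x assume x: "x \<in> F" and cmp: "\<And>y. y \<in> D \<union> E \<Longrightarrow> x \<subseteq> y \<or> y \<subseteq> x"
    show "x \<in> D \<union> E"
    proof (cases "x \<subseteq> \<sigma>")
      case True
      then have "x \<in> D" using x cmp by (intro maxchain_memI[OF D]) auto
      then show ?thesis by simp
    next
      case False
      then have "\<sigma> \<subseteq> x" using cmp[of \<sigma>] sD by auto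
      then have "x \<in> E" using x cmp by (intro maxchain_memI[OF E]) auto
      then show ?thesis by simp
    qed
  qed
qed

lemma card_maxchain_below:
  assumes "finite F" "graded_of_rank F n" "\<sigma> \<in> F"
  obtains m where "m \<le> n" "\<And>D. subset.maxchain (below F \<sigma>) D \<Longrightarrow> card D = m + 1"
proof -
  obtain E where E: "subset.maxchain (above F \<sigma>) E" using subset.Hausdorff by blast
  have finE: "finite E" using maxchain_memD(1)[OF E] assms(1) by (auto intro: finite_subset)
  have sE: "\<sigma> \<in> E" 
    by (rule maxchain_memI[OF E]) (use \<open>\<sigma> \<in> F\<close> maxchain_memD(1)[OF E] in auto)
  have cE: "card E \<ge> 1" using sE finE by (metis One_nat_def Suc_leI card_gt_0_iff empty_iff)
  show thesis
  proof (rule that[of "n + 1 - card E"])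
    show "n + 1 - card E \<le> n" using cE by simp
    fix D assume D: "subset.maxchain (below F \<sigma>) D"
    have finD: "finite D" using maxchain_memD(1)[OF D] assms(1) by (auto intro: finite_subset)
    have "card (D \<union> E) = n + 1"
      using maxchain_glue(2)[OF D E assms(3)] assms(2) by (auto simp: graded_of_rank_def)
    moreover have "card D + card E = card (D \<union> E) + 1"
      using card_Un_Int[OF finD finE] maxchain_glue(1)[OF D E assms(3)] by simp
    moreover have "card D \<ge> 1"
      using maxchain_glue(1)[OF D E assms(3)] finD
      by (metis IntE One_nat_def Suc_leI card_gt_0_iff empty_iff insertI1)
    ultimately show "card D = n + 1 - card E + 1" by simp
  qed
qed

lemma maxchain_below_cover:
  assumes D: "subset.maxchain (below F \<sigma>) D" and cov: "covers F \<tau> \<sigma>"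
  shows "subset.maxchain (below F \<tau>) (insert \<tau> D)" "\<tau> \<notin> D"
proof -
  have \<sigma>\<tau>: "\<sigma> \<in> F" "\<tau> \<in> F" "\<sigma> \<subset> \<tau>" using cov by (auto simp: covers_def)
  have subD: "x \<in> F \<and> x \<subseteq> \<sigma>" if "x \<in> D" for x using maxchain_memD(1)[OF D that] by auto
  have sD: "\<sigma> \<in> D" by (rule maxchain_memI[OF D]) (use \<sigma>\<tau> subD in auto)
  show "\<tau> \<notin> D" using subD \<sigma>\<tau>(3) by blast
  show "subset.maxchain (below F \<tau>) (insert \<tau> D)"
  proof (rule maxchainI)
    show "insert \<tau> D \<subseteq> below F \<tau>" using subD \<sigma>\<tau> by blast
  next
    fix x y assume "x \<in> insert \<tau> D" "y \<in> insert \<tau> D"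
    then show "x \<subseteq> y \<or> y \<subseteq> x" using maxchain_memD(2)[OF D] subD \<sigma>\<tau>(3) by blast
  next
    fix x assume x: "x \<in> below F \<tau>" and cmp: "\<And>y. y \<in> insert \<tau> D \<Longrightarrow> x \<subseteq> y \<or> y \<subseteq> x"
    show "x \<in> insert \<tau> D"
    proof (cases "x \<subseteq> \<sigma>")
      case True
      then have "x \<in> D" using x cmp by (intro maxchain_memI[OF D]) auto
      then show ?thesis by simp
    next
      case False
      then have "\<sigma> \<subset> x" using cmp[of \<sigma>] sD by auto
      then show ?thesis using x cov by (auto simp: covers_def)
    qed
  qed
qed

lemma rank_function_unique:
  assumes "finite_simplicial_complex K" "{} \<in> face_simplices K"
    and "rank_function K rk" "rank_function K rk'" "\<sigma> \<in> face_simplices K"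
  shows "rk \<sigma> = rk' \<sigma>"
proof -
  let ?F = "face_simplices K"
  have "finite \<sigma>" using assms(1,5) by (auto simp: finite_simplicial_complex_def face_simplices_def)
  then show ?thesis using assms(5)
  proof (induction \<sigma> rule: finite_psubset_induct)
    case (psubset \<sigma>)
    show ?case
    proof (cases "\<sigma> = {}")
      case True
      then show ?thesis using assms by (simp add: rank_function_def)
    next
      case False
      let ?L = "{\<tau> \<in> ?F. \<tau> \<subset> \<sigma>}"
      have "finite ?L" using assms(1) by (auto simp: finite_simplicial_complex_def face_simplices_def)
      moreover have "{} \<in> ?L" using False assms(2) by auto
      ultimately obtain \<rho> where \<rho>: "\<rho> \<in> ?L" "\<And>\<tau>. \<tau> \<in> ?L \<Longrightarrow> \<rho> \<subseteq> \<tau> \<Longrightarrow> \<tau> = \<rho>"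
        by (metis (no_types, lifting) empty_iff finite_has_maximal)
      have "covers ?F \<sigma> \<rho>" using \<rho> psubset.prems by (auto simp: covers_def)
      then show ?thesis using assms(3,4) psubset.IH[of \<rho>] \<rho>(1) by (auto simp: rank_function_def)
    qed
  qed
qed

lemma face_rank_eqI:
  assumes "finite_simplicial_complex K" "{} \<in> face_simplices K"
    and "rank_function K rk" "\<sigma> \<in> face_simplices K"
  shows "face_rank K \<sigma> = rk \<sigma>"
  unfolding face_rank_def using assms by (blast intro: the_equality rank_function_unique)

lemma face_rank_maxchain:
  assumes K: "finite_simplicial_complex K" "{} \<in> face_simplices K"
    and gr: "graded_of_rank (face_simplices K) n" and \<sigma>: "\<sigma> \<in> face_simplices K"
    and D: "subset.maxchain (below (face_simplices K) \<sigma>) D"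
  shows "card D = face_rank K \<sigma> + 1" "rank_function K (face_rank K)" "face_rank K \<sigma> \<le> n"
proof -
  let ?F = "face_simplices K"
  have fin: "finite ?F" using K by (auto simp: finite_simplicial_complex_def face_simplices_def)
  have "\<forall>\<sigma>\<in>?F. \<exists>m\<le>n. \<forall>D. subset.maxchain (below ?F \<sigma>) D \<longrightarrow> card D = m + 1"
    using card_maxchain_below[OF fin gr] by metis
  then obtain rk where rk: "\<And>\<sigma>. \<sigma> \<in> ?F \<Longrightarrow> rk \<sigma> \<le> n"
      "\<And>\<sigma> D. \<sigma> \<in> ?F \<Longrightarrow> subset.maxchain (below ?F \<sigma>) D \<Longrightarrow> card D = rk \<sigma> + 1"
    by metis
  have "subset.maxchain (below ?F {}) {{}}" using K(2) by (intro maxchainI) auto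
  then have "rk {} = 0" using rk(2)[OF K(2)] by force
  moreover have "rk \<tau> = rk \<rho> + 1" if cov: "covers ?F \<tau> \<rho>" for \<rho> \<tau>
  proof -
    obtain C where C: "subset.maxchain (below ?F \<rho>) C" using subset.Hausdorff by blast
    have "finite C" using maxchain_memD(1)[OF C] fin by (auto intro: finite_subset)
    then show ?thesis
      using rk(2)[OF _ C] rk(2)[OF _ maxchain_below_cover(1)[OF C cov]]
        maxchain_below_cover(2)[OF C cov] cov by (auto simp: covers_def)
  qed
  ultimately have rf: "rank_function K rk" by (auto simp: rank_function_def)
  have eq: "face_rank K \<tau> = rk \<tau>" if "\<tau> \<in> ?F" for \<tau> using face_rank_eqI[OF K rf that] .
  show "card D = face_rank K \<sigma> + 1" "face_rank K \<sigma> \<le> n" using rk \<sigma> D eq by auto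
  show "rank_function K (face_rank K)"
    using rf eq K(2) by (auto simp: rank_function_def covers_def)
qed

lemma rank_function_face_rank:
  assumes "finite_simplicial_complex K" "{} \<in> face_simplices K"
    and "graded_of_rank (face_simplices K) n"
  shows "rank_function K (face_rank K)"
  using face_rank_maxchain(2)[OF assms assms(2)] subset.Hausdorff by blast

lemma face_rank_le:
  assumes "finite_simplicial_complex K" "{} \<in> face_simplices K"
    and "graded_of_rank (face_simplices K) n" "\<sigma> \<in> face_simplices K"
  shows "face_rank K \<sigma> \<le> n"
  using face_rank_maxchain(3)[OF assms] subset.Hausdorff by blast

lemma face_rank_maximal:
  assumes K: "finite_simplicial_complex K" "{} \<in> face_simplices K"
    and gr: "graded_of_rank (face_simplices K) n" and \<sigma>: "\<sigma> \<in> maximal_simplices K"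
  shows "face_rank K \<sigma> = n"
proof -
  let ?F = "face_simplices K"
  have s: "\<sigma> \<in> ?F" using \<sigma> by (auto simp: face_simplices_def maximal_simplices_def intro!: exI[of _ "{\<sigma>}"])
  obtain D where D: "subset.maxchain (below ?F \<sigma>) D" using subset.Hausdorff by blast
  have ab: "above ?F \<sigma> = {\<sigma>}" using s \<sigma> by (auto simp: face_simplices_def maximal_simplices_def)
  have E: "subset.maxchain (above ?F \<sigma>) {\<sigma>}" unfolding ab by (intro maxchainI) auto
  have "subset.maxchain ?F D"
    using maxchain_glue[OF D E s] by (metis Int_lower1 Un_absorb2)
  then show ?thesis using face_rank_maxchain(1)[OF K gr s D] gr by (auto simp: graded_of_rank_def)
qed

end

theory Submission
  imports Defs
begin

text \<open>
  The map \<open>\<rho> \<mapsto> \<rho> \<union> \<sigma>\<close> is an order isomorphism from the face simplices of the link of \<open>\<sigma>\<close>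
  onto the face simplices of \<open>K\<close> that contain \<open>\<sigma>\<close>. Gluing maximal chains at \<open>\<sigma>\<close> therefore shows
  that the link is graded and that its rank function is the one of \<open>K\<close> shifted by the rank of
  \<open>\<sigma>\<close>. The spheres of the link are those of \<open>K\<close>, since the link of \<open>\<rho>\<close> in the link of \<open>\<sigma>\<close> is the
  link of \<open>\<rho> \<union> \<sigma>\<close> in \<open>K\<close>.
\<close>

lemma simplex_subset:
  assumes "finite_simplicial_complex K" "\<tau> \<in> K" "\<rho> \<subseteq> \<tau>"
  shows "\<rho> \<in> K"
  using assms unfolding finite_simplicial_complex_def by blast

lemma finite_face_simplices:
  assumes "finite_simplicial_complex K"
  shows "finite (face_simplices K)"
  using assms by (auto simp: finite_simplicial_complex_def face_simplices_def)

lemma face_simplicesD: "\<sigma> \<in> face_simplices K \<Longrightarrow> \<sigma> \<in> K"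
  by (simp add: face_simplices_def)

lemma finite_simplicial_complex_link:
  assumes "finite_simplicial_complex K" "\<sigma> \<in> K"
  shows "finite_simplicial_complex (link K \<sigma>)"
proof -
  have "\<tau>' \<in> link K \<sigma>" if \<tau>: "\<tau> \<in> link K \<sigma>" "\<tau>' \<subseteq> \<tau>" for \<tau> \<tau>'
  proof -
    have "\<tau>' \<union> \<sigma> \<subseteq> \<tau> \<union> \<sigma>" using \<tau>(2) by blast
    moreover have "\<tau> \<in> K" "\<tau> \<union> \<sigma> \<in> K" using \<tau>(1) by (simp_all add: link_def)
    ultimately have "\<tau>' \<in> K" "\<tau>' \<union> \<sigma> \<in> K"
      using simplex_subset[OF assms(1)] \<tau>(2) by blast+
    then show ?thesis using \<tau> unfolding link_def by blast
  qed
  moreover have "finite (link K \<sigma>)" "{} \<in> link K \<sigma>" "\<And>\<tau>. \<tau> \<in> link K \<sigma> \<Longrightarrow> finite \<tau>"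
    using assms unfolding finite_simplicial_complex_def link_def by simp_all
  ultimately show ?thesis unfolding finite_simplicial_complex_def by blast
qed

text \<open>Unfolding \<open>link\<close> twice, both sides require
  \<open>\<tau> \<union> \<rho> \<union> \<sigma>\<close> to be a simplex and \<open>\<tau>\<close>
  to avoid \<open>\<rho>\<close> and \<open>\<sigma>\<close>. The other membership conditions follow
  from closure under subsets, and \<open>\<rho> \<inter> \<sigma> = {}\<close> makes the
  disjointness conditions agree.\<close>

lemma link_link:
  assumes "finite_simplicial_complex K" "\<rho> \<inter> \<sigma> = {}"
  shows "link (link K \<sigma>) \<rho> = link K (\<rho> \<union> \<sigma>)"
proof -
  have "\<tau> \<union> \<sigma> \<in> K" "\<tau> \<union> \<rho> \<in> K" if "\<tau> \<union> \<rho> \<union> \<sigma> \<in> K" for \<tau>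
  proof -
    have "\<tau> \<union> \<sigma> \<subseteq> \<tau> \<union> \<rho> \<union> \<sigma>" "\<tau> \<union> \<rho> \<subseteq> \<tau> \<union> \<rho> \<union> \<sigma>" by auto
    then show "\<tau> \<union> \<sigma> \<in> K" "\<tau> \<union> \<rho> \<in> K"
      using simplex_subset[OF assms(1) that] by blast+
  qed
  moreover have "(\<tau> \<union> \<rho>) \<inter> \<sigma> = {} \<longleftrightarrow> \<tau> \<inter> \<sigma> = {}" "\<tau> \<inter> (\<rho> \<union> \<sigma>) = {} \<longleftrightarrow> \<tau> \<inter> \<rho> = {} \<and> \<tau> \<inter> \<sigma> = {}" for \<tau>
    using assms(2) by blast+
  ultimately show ?thesis unfolding link_def by (auto simp: Un_assoc)
qed

text \<open>A simplex \<open>\<tau>\<close> of \<open>K\<close> that strictly extends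
  \<open>\<rho> \<union> \<sigma>\<close> yields \<open>\<tau> - \<sigma>\<close>, a strict
  extension of \<open>\<rho>\<close> in the link; conversely, adding \<open>\<sigma>\<close> turns
  an extension in the link into one in \<open>K\<close>. So maximality transfers in both
  directions.\<close>

lemma mem_maximal_simplices_link_iff:
  assumes K: "finite_simplicial_complex K"
  shows "\<rho> \<in> maximal_simplices (link K \<sigma>) \<longleftrightarrow> \<rho> \<inter> \<sigma> = {} \<and> \<rho> \<union> \<sigma> \<in> maximal_simplices K"
proof (intro iffI conjI)
  assume \<rho>: "\<rho> \<in> maximal_simplices (link K \<sigma>)"
  then show disj: "\<rho> \<inter> \<sigma> = {}" by (auto simp: maximal_simplices_def link_def)
  have "\<tau> = \<rho> \<union> \<sigma>" if \<tau>: "\<tau> \<in> K" "\<rho> \<union> \<sigma> \<subseteq> \<tau>" for \<tau>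
  proof -
    have eq: "\<tau> - \<sigma> \<union> \<sigma> = \<tau>" using \<tau> by auto
    have "\<tau> - \<sigma> \<in> K" using simplex_subset[OF K \<tau>(1)] by blast
    then have "\<tau> - \<sigma> \<in> link K \<sigma>" using \<tau> eq by (auto simp: link_def)
    moreover have "\<rho> \<subseteq> \<tau> - \<sigma>" using \<tau> disj by auto
    ultimately have "\<tau> - \<sigma> = \<rho>" using \<rho> by (auto simp: maximal_simplices_def)
    then show ?thesis using eq by simp
  qed
  then show "\<rho> \<union> \<sigma> \<in> maximal_simplices K"
    using \<rho> by (auto simp: maximal_simplices_def link_def)
next
  assume \<rho>: "\<rho> \<inter> \<sigma> = {} \<and> \<rho> \<union> \<sigma> \<in> maximal_simplices K"
  then have mem: "\<rho> \<union> \<sigma> \<in> K" by (auto simp: maximal_simplices_def)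
  then have "\<rho> \<in> K" using simplex_subset[OF K] by blast
  then have "\<rho> \<in> link K \<sigma>" using \<rho> mem by (auto simp: link_def)
  moreover have "\<tau> = \<rho>" if \<tau>: "\<tau> \<in> link K \<sigma>" "\<rho> \<subseteq> \<tau>" for \<tau>
  proof -
    have disj: "\<tau> \<inter> \<sigma> = {}" and "\<tau> \<union> \<sigma> \<in> K" using \<tau>(1) by (simp_all add: link_def)
    moreover have "\<rho> \<union> \<sigma> \<subseteq> \<tau> \<union> \<sigma>" using \<tau>(2) by blast
    ultimately have "\<tau> \<union> \<sigma> = \<rho> \<union> \<sigma>" using \<rho> by (simp add: maximal_simplices_def)
    then show ?thesis using \<rho> disj by blast
  qed
  ultimately show "\<rho> \<in> maximal_simplices (link K \<sigma>)" by (auto simp: maximal_simplices_def)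
qed

text \<open>Adding or removing \<open>\<sigma>\<close> commutes with intersections of nonempty
  families, so a family of maximal simplices that cuts out one face simplex is translated member by
  member into a family that cuts out the other.\<close>

lemma mem_face_simplices_link_iff:
  assumes K: "finite_simplicial_complex K"
  shows "\<rho> \<in> face_simplices (link K \<sigma>) \<longleftrightarrow> \<rho> \<inter> \<sigma> = {} \<and> \<rho> \<union> \<sigma> \<in> face_simplices K"
proof (intro iffI conjI)
  assume \<rho>: "\<rho> \<in> face_simplices (link K \<sigma>)"
  then show "\<rho> \<inter> \<sigma> = {}" by (auto simp: face_simplices_def link_def)
  obtain S where S: "finite S" "S \<noteq> {}" "S \<subseteq> maximal_simplices (link K \<sigma>)" "\<rho> = \<Inter>S"
    using \<rho> by (auto simp: face_simplices_def)
  let ?S = "(\<lambda>\<tau>. \<tau> \<union> \<sigma>) ` S"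
  have "\<rho> \<union> \<sigma> = \<Inter>?S" using S by auto
  moreover have "?S \<subseteq> maximal_simplices K"
    using S mem_maximal_simplices_link_iff[OF K] by blast
  moreover have "\<rho> \<union> \<sigma> \<in> K" using \<rho> by (auto simp: face_simplices_def link_def)
  moreover have "finite ?S" "?S \<noteq> {}" using S by auto
  ultimately show "\<rho> \<union> \<sigma> \<in> face_simplices K" unfolding face_simplices_def by blast
next
  assume \<rho>: "\<rho> \<inter> \<sigma> = {} \<and> \<rho> \<union> \<sigma> \<in> face_simplices K"
  then obtain S where S: "finite S" "S \<noteq> {}" "S \<subseteq> maximal_simplices K" "\<rho> \<union> \<sigma> = \<Inter>S"
    by (auto simp: face_simplices_def)
  let ?S = "(\<lambda>\<tau>. \<tau> - \<sigma>) ` S"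
  have "\<rho> = \<rho> \<union> \<sigma> - \<sigma>" using \<rho> by auto
  \<comment> \<open>Nonemptiness of \<open>S\<close> matters here: for an empty family the right
    side would be \<open>UNIV\<close>, even after removing \<open>\<sigma>\<close> on the
    left.\<close>
  also have "\<dots> = \<Inter>?S" unfolding S(4) using S(2) by auto
  finally have "\<rho> = \<Inter>?S" .
  moreover have "?S \<subseteq> maximal_simplices (link K \<sigma>)"
  proof
    fix \<tau>' assume "\<tau>' \<in> ?S"
    then obtain \<tau> where \<tau>: "\<tau> \<in> S" "\<tau>' = \<tau> - \<sigma>" by auto
    \<comment> \<open>Each member of \<open>S\<close> contains
      \<open>\<Inter>S = \<rho> \<union> \<sigma>\<close> and hence \<open>\<sigma>\<close>, so
      removing \<open>\<sigma>\<close> loses nothing that adding it back does not restore.\<close>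
    then have "\<tau>' \<union> \<sigma> = \<tau>" using S(4) by auto
    then show "\<tau>' \<in> maximal_simplices (link K \<sigma>)"
      using \<tau> S(3) by (auto simp: mem_maximal_simplices_link_iff[OF K])
  qed
  moreover have "\<rho> \<in> link K \<sigma>"
  proof -
    have mem: "\<rho> \<union> \<sigma> \<in> K" using \<rho> by (auto simp: face_simplices_def)
    then have "\<rho> \<in> K" using simplex_subset[OF K] by blast
    then show ?thesis using \<rho> mem by (auto simp: link_def)
  qed
  moreover have "finite ?S" "?S \<noteq> {}" using S by auto
  ultimately show "\<rho> \<in> face_simplices (link K \<sigma>)" unfolding face_simplices_def by blast
qed

lemma maxchain_image:
  assumes C: "subset.maxchain A C"
    and iso: "\<And>x y. x \<in> A \<Longrightarrow> y \<in> A \<Longrightarrow> f x \<subseteq> f y \<longleftrightarrow> x \<subseteq> y"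
  shows "subset.maxchain (f ` A) (f ` C)"
proof (rule maxchainI)
  show "f ` C \<subseteq> f ` A" using maxchain_memD(1)[OF C] by auto
next
  fix x y assume "x \<in> f ` C" "y \<in> f ` C"
  then obtain a b where ab: "a \<in> C" "b \<in> C" "x = f a" "y = f b" by auto
  then show "x \<subseteq> y \<or> y \<subseteq> x"
    using maxchain_memD(2)[OF C ab(1,2)] iso maxchain_memD(1)[OF C] by simp
next
  fix x assume "x \<in> f ` A" and cmp: "\<And>y. y \<in> f ` C \<Longrightarrow> x \<subseteq> y \<or> y \<subseteq> x"
  then obtain a where a: "a \<in> A" "x = f a" by auto
  have "a \<in> C"
  proof (rule maxchain_memI[OF C a(1)])
    fix c assume "c \<in> C"
    then show "a \<subseteq> c \<or> c \<subseteq> a" using cmp[of "f c"] iso a maxchain_memD(1)[OF C] by simp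
  qed
  then show "x \<in> f ` C" using a by auto
qed

text \<open>
  For \<open>G\<close> the set of all face simplices of \<open>K\<close> this gives gradedness of the link, and for \<open>G\<close> the
  face simplices below a given one it gives the rank in the link.
\<close>

lemma maxchain_link:
  assumes fin: "finite G" and \<sigma>: "\<sigma> \<in> G"
    and C: "subset.maxchain {\<rho>. \<rho> \<inter> \<sigma> = {} \<and> \<rho> \<union> \<sigma> \<in> G} C"
    and D: "subset.maxchain (below G \<sigma>) D"
  obtains E where "subset.maxchain G E" "card E + 1 = card D + card C"
proof -
  let ?A = "{\<rho>. \<rho> \<inter> \<sigma> = {} \<and> \<rho> \<union> \<sigma> \<in> G}" and ?f = "\<lambda>\<rho>. \<rho> \<union> \<sigma>"
  have "\<tau> \<in> ?f ` ?A" if "\<tau> \<in> above G \<sigma>" for \<tau>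
  proof (rule image_eqI[of _ _ "\<tau> - \<sigma>"])
    show "\<tau> = \<tau> - \<sigma> \<union> \<sigma>" using that by auto
    then show "\<tau> - \<sigma> \<in> ?A" using that by auto
  qed
  then have img: "?f ` ?A = above G \<sigma>" by auto
  \<comment> \<open>Among sets disjoint from \<open>\<sigma>\<close>, adding \<open>\<sigma>\<close>
    reflects inclusion as well as preserving it.\<close>
  have "subset.maxchain (?f ` ?A) (?f ` C)" by (rule maxchain_image[OF C]) auto
  then have E: "subset.maxchain (above G \<sigma>) (?f ` C)" unfolding img .
  have "inj_on ?f C"
  proof (rule inj_onI)
    fix x y assume "x \<in> C" "y \<in> C" "x \<union> \<sigma> = y \<union> \<sigma>"
    then show "x = y" using maxchain_memD(1)[OF C] by blast
  qed
  then have card: "card (?f ` C) = card C" by (rule card_image)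
  have "finite D" "finite (?f ` C)"
    using maxchain_memD(1)[OF D] maxchain_memD(1)[OF E] fin by (auto intro: finite_subset[of _ G])
  \<comment> \<open>The two glued chains meet exactly in \<open>\<sigma>\<close>, which is therefore
    counted twice on the right.\<close>
  then have "card (D \<union> ?f ` C) + 1 = card D + card C"
    using card_Un_Int[of D "?f ` C"] maxchain_glue(1)[OF D E \<sigma>] card by simp
  then show thesis using that maxchain_glue(2)[OF D E \<sigma>] by blast
qed

lemma graded_of_rank_link:
  assumes K: "finite_simplicial_complex K" "{} \<in> face_simplices K"
    and gr: "graded_of_rank (face_simplices K) n" and \<sigma>: "\<sigma> \<in> face_simplices K"
  shows "graded_of_rank (face_simplices (link K \<sigma>)) (n - face_rank K \<sigma>)"
  unfolding graded_of_rank_def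
proof (intro allI impI)
  let ?F = "face_simplices K"
  fix C assume "subset.maxchain (face_simplices (link K \<sigma>)) C"
  moreover have "face_simplices (link K \<sigma>) = {\<rho>. \<rho> \<inter> \<sigma> = {} \<and> \<rho> \<union> \<sigma> \<in> ?F}"
    using mem_face_simplices_link_iff[OF K(1)] by blast
  ultimately have C: "subset.maxchain {\<rho>. \<rho> \<inter> \<sigma> = {} \<and> \<rho> \<union> \<sigma> \<in> ?F} C" by simp
  have fin: "finite ?F" using finite_face_simplices[OF K(1)] .
  obtain D where D: "subset.maxchain (below ?F \<sigma>) D" using subset.Hausdorff by blast
  obtain E where E: "subset.maxchain ?F E" "card E + 1 = card D + card C"
    using maxchain_link[OF fin \<sigma> C D] .
  have "card E = n + 1" using E(1) gr by (auto simp: graded_of_rank_def)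
  \<comment> \<open>Since \<open>card D\<close> is the rank of \<open>\<sigma>\<close> plus 1, the
    count gives \<open>card C\<close> plus that rank equal to \<open>n + 1\<close>. The bound of the
    rank by \<open>n\<close> makes the truncated subtraction exact.\<close>
  then show "card C = n - face_rank K \<sigma> + 1"
    using face_rank_maxchain(1,3)[OF K gr \<sigma> D] E(2) by simp
qed

text \<open>A rank is one less than the cardinality of any maximal chain below the face simplex, so
  all three ranks can be read off from a single glued chain ending at
  \<open>\<rho> \<union> \<sigma>\<close>.\<close>

lemma face_rank_link:
  assumes K: "finite_simplicial_complex K" "{} \<in> face_simplices K"
    and gr: "graded_of_rank (face_simplices K) n" and \<sigma>: "\<sigma> \<in> face_simplices K"
    and \<rho>: "\<rho> \<in> face_simplices (link K \<sigma>)"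
  shows "face_rank K (\<rho> \<union> \<sigma>) = face_rank K \<sigma> + face_rank (link K \<sigma>) \<rho>"
proof -
  let ?F = "face_simplices K" and ?L = "link K \<sigma>"
  let ?G = "below ?F (\<rho> \<union> \<sigma>)"
  have \<rho>\<sigma>: "\<rho> \<inter> \<sigma> = {}" "\<rho> \<union> \<sigma> \<in> ?F" using \<rho> mem_face_simplices_link_iff[OF K(1)] by auto
  have fin: "finite ?G" using finite_face_simplices[OF K(1)] by simp
  have \<sigma>G: "\<sigma> \<in> ?G" using \<sigma> by auto
  have L: "finite_simplicial_complex ?L" "{} \<in> face_simplices ?L"
    using finite_simplicial_complex_link[OF K(1) face_simplicesD[OF \<sigma>]] \<sigma>
    by (simp_all add: mem_face_simplices_link_iff[OF K(1)])
  obtain D where D: "subset.maxchain (below ?F \<sigma>) D" using subset.Hausdorff by blast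
  have "below ?F \<sigma> = below ?G \<sigma>" by auto
  then have DG: "subset.maxchain (below ?G \<sigma>) D" using D by simp
  obtain C where C: "subset.maxchain (below (face_simplices ?L) \<rho>) C"
    using subset.Hausdorff by blast
  \<comment> \<open>For a set \<open>\<tau>\<close> disjoint from \<open>\<sigma>\<close>,
    \<open>\<tau> \<union> \<sigma> \<subseteq> \<rho> \<union> \<sigma>\<close> is equivalent to
    \<open>\<tau> \<subseteq> \<rho>\<close>.\<close>
  have "below (face_simplices ?L) \<rho> = {\<rho>. \<rho> \<inter> \<sigma> = {} \<and> \<rho> \<union> \<sigma> \<in> ?G}"
    using mem_face_simplices_link_iff[OF K(1)] by blast
  then have CG: "subset.maxchain {\<rho>. \<rho> \<inter> \<sigma> = {} \<and> \<rho> \<union> \<sigma> \<in> ?G} C" using C by simp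
  obtain E where E: "subset.maxchain ?G E" "card E + 1 = card D + card C"
    using maxchain_link[OF fin \<sigma>G CG DG] .
  show ?thesis
    using face_rank_maxchain(1)[OF K gr \<rho>\<sigma>(2) E(1)] face_rank_maxchain(1)[OF K gr \<sigma> D]
      face_rank_maxchain(1)[OF L graded_of_rank_link[OF K gr \<sigma>] \<rho> C] E(2)
    by simp
qed

theorem proposition4:
  fixes K :: "'a set set" and \<sigma> :: "'a set" and n k :: nat
  assumes "P_complex K n"
    and "\<sigma> \<in> face_simplices K"
    and "face_rank K \<sigma> = k"
  shows "P_complex (link K \<sigma>) (n - k)"
proof -
  have K: "finite_simplicial_complex K" "{} \<in> face_simplices K"
      and gr: "graded_of_rank (face_simplices K) n"
    using assms(1) by (auto simp: P_complex_def)
  have "\<exists>Z. finite_simplicial_complex Z \<and> Z \<subseteq> link (link K \<sigma>) \<rho> \<and>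
        realization Z homeomorphic_space sphere_pred (n - k - face_rank (link K \<sigma>) \<rho>) \<and>
        strong_deformation_retract_of (topspace (realization Z)) (realization (link (link K \<sigma>) \<rho>))"
    if \<rho>: "\<rho> \<in> face_simplices (link K \<sigma>)" for \<rho>
  proof -
    have \<rho>\<sigma>: "\<rho> \<inter> \<sigma> = {}" "\<rho> \<union> \<sigma> \<in> face_simplices K"
      using \<rho> mem_face_simplices_link_iff[OF K(1)] by auto
    \<comment> \<open>The sphere required at \<open>\<rho>\<close> in the link thus has the
      dimension of the one at \<open>\<rho> \<union> \<sigma>\<close> in \<open>K\<close>, so the
      same \<open>Z\<close> serves as witness.\<close>
    have "n - k - face_rank (link K \<sigma>) \<rho> = n - face_rank K (\<rho> \<union> \<sigma>)"
      using face_rank_link[OF K gr assms(2) \<rho>] assms(3) by simp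
    then show ?thesis
      using assms(1) \<rho>\<sigma> link_link[OF K(1) \<rho>\<sigma>(1)] by (simp add: P_complex_def)
  qed
  \<comment> \<open>For the empty set the criterion reduces to \<open>\<sigma>\<close> being a face
    simplex of \<open>K\<close>. This is where an arbitrary simplex \<open>\<sigma>\<close> would
    not do.\<close>
  moreover have "{} \<in> face_simplices (link K \<sigma>)"
    using assms(2) by (simp add: mem_face_simplices_link_iff[OF K(1)])
  moreover have "finite_simplicial_complex (link K \<sigma>)"
    using finite_simplicial_complex_link[OF K(1) face_simplicesD[OF assms(2)]] .
  ultimately show ?thesis
    using graded_of_rank_link[OF K gr assms(2)] assms(3) by (simp add: P_complex_def)
qed

end
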